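(* If $\Omega$ is a finite commutative ring, then $K(\Omega)$ is not a simplicial decomposition (triangulation) of the Klein bottle, and it is not a simplicial decomposition of the real projective plane.
   Context: Rings are commutative with $1\neq0$. $K(\Omega)$ is the clique complex of the zero-divisor graph $\Gamma(\Omega)$, whose vertices are the nonzero zero-divisors of $\Omega$ and in which distinct $a,b$ are adjacent iff $ab=0$. A simplicial complex is a simplicial decomposition of a space if its geometric realization is homeomorphic to that space. *)

theory Defs
  imports "HOL-Analysis.Analysis" "HOL-Algebra.Ring"
begin

definition zero_divisors :: "('a, 'b) ring_scheme \<Rightarrow> 'a set" where
  "zero_divisors R =
     {a \<in> carrier R. \<exists>b \<in> carrier R. b \<noteq> \<zero>\<^bsub>R\<^esub> \<and> a \<otimes>\<^bsub>R\<^esub> b = \<zero>\<^bsub>R\<^esub>}"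

definition zdg_verts :: "('a, 'b) ring_scheme \<Rightarrow> 'a set" where
  "zdg_verts R = zero_divisors R - {\<zero>\<^bsub>R\<^esub>}"

definition zdg_adj :: "('a, 'b) ring_scheme \<Rightarrow> 'a \<Rightarrow> 'a \<Rightarrow> bool" where
  "zdg_adj R a b \<longleftrightarrow> a \<noteq> b \<and> a \<otimes>\<^bsub>R\<^esub> b = \<zero>\<^bsub>R\<^esub>"

text \<open>Abstract simplicial complexes are represented by their sets of nonempty finite simplices.\<close>

definition clique_complex :: "'a set \<Rightarrow> ('a \<Rightarrow> 'a \<Rightarrow> bool) \<Rightarrow> 'a set set" where
  "clique_complex V E = {\<sigma>. \<sigma> \<subseteq> V \<and> finite \<sigma> \<and> \<sigma> \<noteq> {} \<and> pairwise E \<sigma>}"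

definition zdg_complex :: "('a, 'b) ring_scheme \<Rightarrow> 'a set set" where
  "zdg_complex R = clique_complex (zdg_verts R) (zdg_adj R)"

text \<open>Points are given by barycentric coordinates. The topology is the one induced from the product
  topology on real-valued functions; it is the usual (coherent) topology of the realization
  whenever the complex is finite, the only case needed here.\<close>

definition geometric_realization :: "'a set set \<Rightarrow> ('a \<Rightarrow> real) topology" where
  "geometric_realization K =
     top_of_set {t. (\<forall>v. 0 \<le> t v) \<and> {v. t v \<noteq> 0} \<in> K \<and> (\<Sum>v | t v \<noteq> 0. t v) = 1}"

definition simplicial_decomposition :: "'a set set \<Rightarrow> 'b topology \<Rightarrow> bool" where
  "simplicial_decomposition K X \<longleftrightarrow> geometric_realization K homeomorphic_space X"

text \<open>Meaningful only if \<open>r\<close> is an equivalence relation on the topspace of \<open>X\<close>.\<close>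

definition quotient_topology :: "'a topology \<Rightarrow> ('a \<times> 'a) set \<Rightarrow> 'a set topology" where
  "quotient_topology X r = topology (\<lambda>\<U>. \<U> \<subseteq> topspace X // r \<and> openin X (\<Union>\<U>))"

lemma openin_quotient_topology:
  assumes r: "equiv (topspace X) r"
  shows "openin (quotient_topology X r) \<U> \<longleftrightarrow> \<U> \<subseteq> topspace X // r \<and> openin X (\<Union>\<U>)"
proof -
  have Int: "\<Union>(\<U> \<inter> \<V>) = \<Union>\<U> \<inter> \<Union>\<V>"
    if "\<U> \<subseteq> topspace X // r" "\<V> \<subseteq> topspace X // r" for \<U> \<V>
  proof
    show "\<Union>\<U> \<inter> \<Union>\<V> \<subseteq> \<Union>(\<U> \<inter> \<V>)"
    proof
      fix x assume "x \<in> \<Union>\<U> \<inter> \<Union>\<V>"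
      then obtain A B where AB: "A \<in> \<U>" "B \<in> \<V>" "x \<in> A" "x \<in> B" by blast
      have "A \<in> topspace X // r" "B \<in> topspace X // r" using AB that by auto
      from quotient_disj[OF r this] have "A = B" using AB(3,4) by (metis IntI emptyE)
      then have "A \<in> \<U> \<inter> \<V>" using AB(1,2) by simp
      then show "x \<in> \<Union>(\<U> \<inter> \<V>)" using AB(3) by (rule UnionI)
    qed
  qed blast
  have Un: "openin X (\<Union>(\<Union>\<K>))" if "\<forall>\<U>\<in>\<K>. openin X (\<Union>\<U>)" for \<K>
  proof -
    have "\<Union>(\<Union>\<K>) = \<Union>(Union ` \<K>)" by blast
    then show ?thesis using that by auto
  qed
  have "istopology (\<lambda>\<U>. \<U> \<subseteq> topspace X // r \<and> openin X (\<Union>\<U>))"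
    unfolding istopology_def
  proof (intro conjI allI impI)
    fix \<U> \<V>
    assume "\<U> \<subseteq> topspace X // r \<and> openin X (\<Union>\<U>)" "\<V> \<subseteq> topspace X // r \<and> openin X (\<Union>\<V>)"
    then show "\<U> \<inter> \<V> \<subseteq> topspace X // r" "openin X (\<Union>(\<U> \<inter> \<V>))"
      using Int[of \<U> \<V>] by (auto intro: openin_Int)
  next
    fix \<K> assume K: "\<forall>\<U>\<in>\<K>. \<U> \<subseteq> topspace X // r \<and> openin X (\<Union>\<U>)"
    then show "\<Union>\<K> \<subseteq> topspace X // r" by blast
    show "openin X (\<Union>(\<Union>\<K>))" using K by (intro Un) blast
  qed
  then show ?thesis by (simp add: quotient_topology_def)
qed

lemma topspace_quotient_topology:
  assumes r: "equiv (topspace X) r"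
  shows "topspace (quotient_topology X r) = topspace X // r"
proof -
  have "openin (quotient_topology X r) (topspace X // r)"
    by (simp add: openin_quotient_topology[OF r] Union_quotient[OF r])
  then show ?thesis
    using openin_topspace[of "quotient_topology X r", unfolded openin_quotient_topology[OF r]]
    by (simp add: openin_subset subset_antisym)
qed

lemma quotient_map_quotient_topology:
  assumes r: "equiv (topspace X) r"
  shows "quotient_map X (quotient_topology X r) (\<lambda>x. r `` {x})"
proof -
  have "{x \<in> topspace X. r `` {x} \<in> \<U>} = \<Union>\<U>" if U: "\<U> \<subseteq> topspace X // r" for \<U>
  proof
    show "{x \<in> topspace X. r `` {x} \<in> \<U>} \<subseteq> \<Union>\<U>"
      using equiv_class_self[OF r] by blast
    show "\<Union>\<U> \<subseteq> {x \<in> topspace X. r `` {x} \<in> \<U>}"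
    proof
      fix x assume "x \<in> \<Union>\<U>"
      then obtain A where A: "A \<in> \<U>" "x \<in> A" by blast
      then obtain y where y: "y \<in> topspace X" "A = r `` {y}" using U by (auto elim: quotientE)
      then have "(y, x) \<in> r" using A by simp
      then have "A = r `` {x}" "x \<in> topspace X"
        using equiv_class_eq[OF r] equiv_type[OF r] y by auto
      then show "x \<in> {x \<in> topspace X. r `` {x} \<in> \<U>}" using A by simp
    qed
  qed
  then show ?thesis
    unfolding quotient_map_def topspace_quotient_topology[OF r] openin_quotient_topology[OF r]
    by (simp add: quotient_def image_def) blast
qed

definition unit_square :: "(real \<times> real) set" where
  "unit_square = {0..1} \<times> {0..1}"

inductive klein_glue :: "real \<times> real \<Rightarrow> real \<times> real \<Rightarrow> bool" where
  "y \<in> {0..1} \<Longrightarrow> klein_glue (0, y) (1, y)"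
| "x \<in> {0..1} \<Longrightarrow> klein_glue (x, 0) (1 - x, 1)"

definition klein_rel :: "((real \<times> real) \<times> (real \<times> real)) set" where
  "klein_rel = {(p, q). p \<in> unit_square \<and> q \<in> unit_square \<and> equivclp klein_glue p q}"

definition klein_bottle :: "(real \<times> real) set topology" where
  "klein_bottle = quotient_topology (top_of_set unit_square) klein_rel"

lemma equiv_klein_rel: "equiv (topspace (top_of_set unit_square)) klein_rel"
proof (rule equivI)
  show "sym klein_rel"
    by (rule symI) (auto simp only: klein_rel_def mem_Collect_eq split_conv intro: equivclp_sym)
  show "trans klein_rel"
    by (rule transI) (simp only: klein_rel_def mem_Collect_eq split_conv, blast intro: equivclp_trans)
qed (auto simp: klein_rel_def refl_on_def)

definition antipodal_rel :: "((real ^ 3) \<times> (real ^ 3)) set" where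
  "antipodal_rel = {(x, y). x \<in> sphere 0 1 \<and> y \<in> sphere 0 1 \<and> (y = x \<or> y = - x)}"

definition real_projective_plane :: "(real ^ 3) set topology" where
  "real_projective_plane = quotient_topology (top_of_set (sphere 0 1)) antipodal_rel"

lemma equiv_antipodal_rel: "equiv (topspace (top_of_set (sphere 0 1))) antipodal_rel"
proof (rule equivI)
  show "trans antipodal_rel"
    by (rule transI) (simp only: antipodal_rel_def mem_Collect_eq split_conv, elim conjE disjE, simp_all)
qed (auto simp: antipodal_rel_def refl_on_def sym_def)

end

theory Submission
  imports Defs
begin

text \<open>
  The argument is local: a complex with finitely many vertices cannot be a triangulated closed
  surface if some edge lies in fewer than two triangles, or if some simplex has dimension three.
  A zero-divisor complex shows one of these defects unless it is empty or a single vertex.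

  For a ring with an idempotent \<open>e\<close> other than \<open>0\<close> and \<open>1\<close>, the edge \<open>{e, 1 - e}\<close> lies in no
  triangle, since anything annihilated by both \<open>e\<close> and \<open>1 - e\<close> is annihilated by their sum
  (\<open>not_almost_surface_idempotent\<close>). In a finite ring without such an idempotent every
  zero-divisor is nilpotent, because some positive power of it is idempotent and is not \<open>1\<close>. Then a
  single nonzero \<open>s\<close> annihilates all zero-divisors (\<open>ex_common_annihilator\<close>), so the complex is a
  cone with apex \<open>s\<close>. If a cone has no simplex of dimension three, then in a simplex \<open>{s, a, b}\<close> the
  edge \<open>{a, b}\<close> lies in no triangle but this one, because another triangle \<open>{a, b, c}\<close> would
  give the simplex \<open>{s, a, b, c}\<close>; a cone of dimension one consists of edges in no triangle, and a
  cone of dimension zero is a point (\<open>not_almost_surface_cone\<close>).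

  The topological side needs only charts modelled on the plane, and only at all but finitely many
  points. Near a point of an edge that lies in at most one triangle the realization embeds in a
  closed half-plane, with the edge on the boundary line, and invariance of domain forbids a chart
  there (\<open>not_almost_surface_free_edge\<close>); an open solid inside a tetrahedron would embed in the plane,
  against invariance of dimension (\<open>almost_surface_no_solid\<close>). The Klein bottle and the projective
  plane do have such charts.
\<close>

section \<open>Planar charts\<close>

definition chart_at :: "'b topology \<Rightarrow> 'b \<Rightarrow> bool" where
  "chart_at X x \<longleftrightarrow> (\<exists>(V :: (real \<times> real) set) g. open V \<and> x \<in> g ` V \<and>
     continuous_map (top_of_set V) X g \<and> open_map (top_of_set V) X g \<and> inj_on g V)"

text \<open>
  Finitely many points may fail to have a chart. On the Klein bottle this spares the corner of the
  square, where four sheets would have to be pasted. Requiring a point outside the exceptional set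
  excludes finite spaces, and with them the complexes consisting of a single vertex.
\<close>

definition almost_surface :: "'b topology \<Rightarrow> bool" where
  "almost_surface X \<longleftrightarrow>
     (\<exists>F. finite F \<and> \<not> topspace X \<subseteq> F \<and> (\<forall>x\<in>topspace X - F. chart_at X x))"

lemma chart_at_homeomorphic_map:
  assumes f: "homeomorphic_map X Y f" and x: "chart_at X x"
  shows "chart_at Y (f x)"
proof -
  obtain V :: "(real \<times> real) set" and g where g: "open V" "x \<in> g ` V" "inj_on g V"
      "continuous_map (top_of_set V) X g" "open_map (top_of_set V) X g"
    using x unfolding chart_at_def by blast
  have "g ` V \<subseteq> topspace X"
    using continuous_map_image_subset_topspace[OF g(4)] by simp
  then have "inj_on (f \<circ> g) V"
    using g(3) homeomorphic_imp_injective_map[OF f] by (auto intro: comp_inj_on inj_on_subset)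
  moreover have "continuous_map (top_of_set V) Y (f \<circ> g)"
    using g(4) homeomorphic_imp_continuous_map[OF f] by (rule continuous_map_compose)
  moreover have "open_map (top_of_set V) Y (f \<circ> g)"
    using g(5) homeomorphic_imp_open_map[OF f] by (rule open_map_compose)
  moreover have "f x \<in> (f \<circ> g) ` V" using g(2) by auto
  ultimately show ?thesis unfolding chart_at_def using g(1) by blast
qed

lemma almost_surface_homeomorphic_space:
  assumes "X homeomorphic_space Y" and X: "almost_surface X"
  shows "almost_surface Y"
proof -
  obtain f where f: "homeomorphic_map X Y f"
    using assms(1) unfolding homeomorphic_space by blast
  have surj: "f ` topspace X = topspace Y" using homeomorphic_imp_surjective_map[OF f] .
  have inj: "inj_on f (topspace X)" using homeomorphic_imp_injective_map[OF f] .
  obtain F where F: "finite F" "\<not> topspace X \<subseteq> F" "\<forall>x\<in>topspace X - F. chart_at X x"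
    using X unfolding almost_surface_def by blast
  let ?F = "f ` (F \<inter> topspace X)"
  have "finite ?F" using F(1) by simp
  moreover have "\<not> topspace Y \<subseteq> ?F"
  proof
    assume "topspace Y \<subseteq> ?F"
    then have "f ` topspace X \<subseteq> f ` (F \<inter> topspace X)" using surj by simp
    then have "topspace X \<subseteq> F \<inter> topspace X"
      using inj by (simp add: inj_on_image_subset_iff)
    then show False using F(2) by simp
  qed
  moreover have "chart_at Y y" if "y \<in> topspace Y - ?F" for y
  proof -
    have "y \<in> f ` topspace X" using surj that by simp
    then obtain x where "x \<in> topspace X" "y = f x" by (rule imageE)
    then have "x \<in> topspace X - F" using that by blast
    then show ?thesis using F(3) chart_at_homeomorphic_map[OF f] \<open>y = f x\<close> by simp
  qed
  ultimately show ?thesis unfolding almost_surface_def by blast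
qed

lemma almost_surface_ex_chart:
  assumes "almost_surface X" "infinite S" "S \<subseteq> topspace X"
  obtains x where "x \<in> S" "chart_at X x"
proof -
  obtain F where F: "finite F" "\<forall>x\<in>topspace X - F. chart_at X x"
    using assms(1) unfolding almost_surface_def by blast
  have "\<not> S \<subseteq> F" using F(1) assms(2) finite_subset by blast
  then show ?thesis using that F(2) assms(3) by blast
qed

lemma almost_surface_infinite:
  assumes "almost_surface X"
  shows "infinite (topspace X)"
proof
  assume fin: "finite (topspace X)"
  obtain x where "chart_at X x" using assms unfolding almost_surface_def by blast
  then obtain V :: "(real \<times> real) set" and g where g: "open V" "x \<in> g ` V" "inj_on g V"
      "continuous_map (top_of_set V) X g"
    unfolding chart_at_def by blast
  have "g ` V \<subseteq> topspace X"
    using continuous_map_image_subset_topspace[OF g(4)] by simp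
  then have "finite (g ` V)" using fin by (rule finite_subset)
  then have "finite V" using g(3) by (rule finite_imageD)
  then show False using g(1,2) finite_imp_not_open by blast
qed

text \<open>
  If \<open>W\<close> has coordinates \<open>\<phi>\<close>, then, seen in these coordinates, some point of any given infinite
  part of \<open>W\<close> lies in an injective image of an open planar set. Any infinite \<open>S\<close> will do because it
  cannot consist of exceptional points only.
\<close>

lemma almost_surface_planar_image:
  fixes \<phi> :: "'b \<Rightarrow> 'c :: topological_space"
  assumes X: "almost_surface X" and W: "openin X W" and S: "S \<subseteq> W" "infinite S"
    and cont: "continuous_map (subtopology X W) euclidean \<phi>" and inj: "inj_on \<phi> W"
  obtains V :: "(real \<times> real) set" and h x where "open V" "continuous_on V h" "inj_on h V"
    "h ` V \<subseteq> \<phi> ` W" "x \<in> S" "\<phi> x \<in> h ` V"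
proof -
  obtain x where x: "x \<in> S" "chart_at X x"
    using almost_surface_ex_chart[OF X S(2)] S(1) openin_subset[OF W] by blast
  then obtain V :: "(real \<times> real) set" and g where g: "open V" "x \<in> g ` V" "inj_on g V"
      "continuous_map (top_of_set V) X g"
    unfolding chart_at_def by blast
  define V' where "V' = {v \<in> V. g v \<in> W}"
  have "openin (top_of_set V) V'"
    using openin_continuous_map_preimage[OF g(4) W] by (simp add: V'_def)
  then have V': "open V'" using g(1) openin_open_eq by blast
  have "V' \<subseteq> V" by (auto simp: V'_def)
  have "continuous_map (top_of_set V') (subtopology X W) g"
    using continuous_map_from_subtopology_mono[OF g(4) \<open>V' \<subseteq> V\<close>]
    by (simp add: continuous_map_in_subtopology V'_def image_subset_iff)
  then have "continuous_map (top_of_set V') euclidean (\<phi> \<circ> g)"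
    using cont by (rule continuous_map_compose)
  then have "continuous_on V' (\<phi> \<circ> g)" by simp
  moreover have "inj_on (\<phi> \<circ> g) V'"
  proof (rule comp_inj_on)
    show "inj_on g V'" using g(3) \<open>V' \<subseteq> V\<close> by (rule inj_on_subset)
    show "inj_on \<phi> (g ` V')" by (rule inj_on_subset[OF inj]) (auto simp: V'_def)
  qed
  moreover have "(\<phi> \<circ> g) ` V' \<subseteq> \<phi> ` W" "\<phi> x \<in> (\<phi> \<circ> g) ` V'"
    using g(2) x(1) S(1) by (auto simp: V'_def)
  ultimately show ?thesis using that V' x(1) by blast
qed

text \<open>
  The image of \<open>D\<close> meets the range of some chart, and inverting the chart on that part gives a
  continuous injection from an open subset of three-space into the plane. This is where charts have
  to be open maps: the range must be open for the part of \<open>D\<close> above it to be open.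
\<close>

lemma almost_surface_no_solid:
  fixes D :: "(real \<times> real \<times> real) set"
  assumes X: "almost_surface X" and D: "open D" "D \<noteq> {}"
    and cont: "continuous_map (top_of_set D) X \<psi>" and inj: "inj_on \<psi> D"
  shows False
proof -
  have "infinite D" using D finite_imp_not_open by blast
  then have "infinite (\<psi> ` D)" using inj by (simp add: finite_image_iff)
  moreover have "\<psi> ` D \<subseteq> topspace X"
    using continuous_map_image_subset_topspace[OF cont] by simp
  ultimately obtain x where x: "x \<in> \<psi> ` D" "chart_at X x"
    using almost_surface_ex_chart[OF X] by blast
  then obtain V :: "(real \<times> real) set" and g where g: "open V" "x \<in> g ` V" "inj_on g V"
      "continuous_map (top_of_set V) X g" "open_map (top_of_set V) X g"
    unfolding chart_at_def by blast
  define U where "U = g ` V"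
  have U: "openin X U" using g(5) unfolding open_map_def U_def by auto
  have "open_map (top_of_set V) (subtopology X U) g"
    using g(5) by (intro open_map_into_subtopology) (auto simp: U_def)
  moreover have "continuous_map (top_of_set V) (subtopology X U) g"
    using g(4) by (simp add: continuous_map_in_subtopology U_def)
  moreover have "g ` topspace (top_of_set V) = topspace (subtopology X U)"
    using openin_subset[OF U] by (auto simp: U_def)
  ultimately have "homeomorphic_map (top_of_set V) (subtopology X U) g"
    using g(3) by (intro bijective_open_imp_homeomorphic_map) auto
  then obtain h where h: "homeomorphic_maps (top_of_set V) (subtopology X U) g h"
    unfolding homeomorphic_map_maps by blast
  then have hc: "continuous_map (subtopology X U) (top_of_set V) h"
    by (simp add: homeomorphic_maps_def)
  have gh: "g (h y) = y" if "y \<in> U" for y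
    using h that openin_subset[OF U] by (auto simp: homeomorphic_maps_def)
  define D' where "D' = {u \<in> D. \<psi> u \<in> U}"
  have "openin (top_of_set D) D'"
    using openin_continuous_map_preimage[OF cont U] by (simp add: D'_def)
  then have D': "open D'" using D(1) openin_open_eq by blast
  have "D' \<subseteq> D" by (auto simp: D'_def)
  have "continuous_map (top_of_set D') (subtopology X U) \<psi>"
    using continuous_map_from_subtopology_mono[OF cont \<open>D' \<subseteq> D\<close>]
    by (simp add: continuous_map_in_subtopology D'_def image_subset_iff)
  then have "continuous_map (top_of_set D') (top_of_set V) (h \<circ> \<psi>)"
    using hc by (rule continuous_map_compose)
  then have c: "continuous_on D' (h \<circ> \<psi>)" by (simp add: continuous_map_in_subtopology)
  have i: "inj_on (h \<circ> \<psi>) D'"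
  proof (rule inj_onI)
    fix u u' assume u: "u \<in> D'" "u' \<in> D'" "(h \<circ> \<psi>) u = (h \<circ> \<psi>) u'"
    then have U': "\<psi> u \<in> U" "\<psi> u' \<in> U" "u \<in> D" "u' \<in> D" by (auto simp: D'_def)
    have "g (h (\<psi> u)) = g (h (\<psi> u'))" using u(3) by simp
    then have "\<psi> u = \<psi> u'" using gh U'(1,2) by simp
    then show "u = u'" using inj U'(3,4) by (simp add: inj_on_eq_iff)
  qed
  have "D' \<noteq> {}" using x(1) g(2) by (auto simp: D'_def U_def)
  then have "DIM(real \<times> real \<times> real) \<le> DIM(real \<times> real)"
    by (rule invariance_of_dimension[OF c D' i])
  then show False by simp
qed

section \<open>Complexes that no surface admits\<close>

lemma topspace_geometric_realization:
  "topspace (geometric_realization K) =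
     {t. (\<forall>v. 0 \<le> t v) \<and> {v. t v \<noteq> 0} \<in> K \<and> (\<Sum>v | t v \<noteq> 0. t v) = 1}"
  by (simp add: geometric_realization_def)

lemma continuous_map_geometric_realization_coordinate:
  "continuous_map (geometric_realization K) euclideanreal (\<lambda>t. t v)"
  unfolding geometric_realization_def
  by (auto intro: continuous_on_subset[OF continuous_on_product_coordinates])

lemma openin_geometric_realization_star:
  "openin (geometric_realization K) {t \<in> topspace (geometric_realization K). 0 < t v}"
proof -
  have "openin (geometric_realization K) {t \<in> topspace (geometric_realization K). t v \<in> {0<..}}"
    by (rule openin_continuous_map_preimage[OF continuous_map_geometric_realization_coordinate]) simp
  then show ?thesis by simp
qed

lemma sum_geometric_realization:
  assumes "t \<in> topspace (geometric_realization K)" "{v. t v \<noteq> 0} \<subseteq> \<sigma>" "finite \<sigma>"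
  shows "(\<Sum>v\<in>\<sigma>. t v) = 1"
proof -
  have "(\<Sum>v\<in>\<sigma>. t v) = (\<Sum>v | t v \<noteq> 0. t v)"
    using assms(2,3) by (intro sum.mono_neutral_right) auto
  then show ?thesis using assms(1) by (simp add: topspace_geometric_realization)
qed

text \<open>
  On the open star of \<open>{a, b}\<close> the coordinates at \<open>a\<close> and \<open>b\<close> determine a point, since only \<open>s\<close> can
  carry the remaining weight \<open>1 - t a - t b\<close>. This weight is nonnegative and vanishes on the edge, so
  the star becomes part of a half-plane and the edge part of its boundary line. The choice
  \<open>s \<in> {a, b}\<close> covers edges that lie in no triangle.
\<close>

lemma not_almost_surface_free_edge:
  assumes ab: "a \<noteq> b" "{a, b} \<in> K"
    and free: "\<And>\<rho>. \<rho> \<in> K \<Longrightarrow> {a, b} \<subseteq> \<rho> \<Longrightarrow> \<rho> \<subseteq> {s, a, b}"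
  shows "\<not> almost_surface (geometric_realization K)"
proof
  let ?X = "geometric_realization K"
  assume X: "almost_surface ?X"
  define W where "W = {t \<in> topspace ?X. 0 < t a} \<inter> {t \<in> topspace ?X. 0 < t b}"
  have W: "openin ?X W"
    unfolding W_def by (intro openin_Int openin_geometric_realization_star)
  have supp: "{v. t v \<noteq> 0} \<subseteq> {s, a, b}" and total: "(\<Sum>v\<in>{s, a, b}. t v) = 1"
    and nonneg: "\<And>v. 0 \<le> t v" if "t \<in> W" for t
  proof -
    show supp: "{v. t v \<noteq> 0} \<subseteq> {s, a, b}"
      using that by (intro free) (auto simp: W_def topspace_geometric_realization)
    show "(\<Sum>v\<in>{s, a, b}. t v) = 1"
      using that by (intro sum_geometric_realization supp) (auto simp: W_def)
    show "\<And>v. 0 \<le> t v" using that by (auto simp: W_def topspace_geometric_realization)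
  qed
  define \<phi> :: "('a \<Rightarrow> real) \<Rightarrow> real \<times> real" where "\<phi> = (\<lambda>t. (1 - t a - t b, t a))"
  have cont: "continuous_map (subtopology ?X W) euclidean \<phi>"
    unfolding \<phi>_def
    by (intro continuous_map_from_subtopology)
       (auto simp: geometric_realization_def intro!: continuous_intros
             continuous_on_subset[OF continuous_on_product_coordinates])
  have inj: "inj_on \<phi> W"
  proof (rule inj_onI)
    fix t t' assume t: "t \<in> W" "t' \<in> W" "\<phi> t = \<phi> t'"
    then have eq: "t a = t' a" "t b = t' b" by (auto simp: \<phi>_def)
    have "t s = t' s"
      using total[OF t(1)] total[OF t(2)] ab(1) eq by (cases "s \<in> {a, b}") auto
    moreover have "t v = 0 \<and> t' v = 0" if "v \<notin> {s, a, b}" for v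
      using supp[OF t(1)] supp[OF t(2)] that by auto
    ultimately have "t v = t' v" for v using eq by (cases "v \<in> {s, a, b}") auto
    then show "t = t'" by (rule ext)
  qed
  \<comment> \<open>The points of the open edge, where no chart can exist.\<close>
  define e :: "real \<Rightarrow> 'a \<Rightarrow> real" where
    "e u = (\<lambda>v. if v = a then u else if v = b then 1 - u else 0)" for u
  have eW: "e u \<in> W" if "u \<in> {0<..<1}" for u
  proof -
    have "{v. e u v \<noteq> 0} = {a, b}" using that by (auto simp: e_def)
    moreover have "0 \<le> e u v" for v using that by (simp add: e_def)
    moreover have "(\<Sum>v\<in>{a, b}. e u v) = 1" using ab(1) by (simp add: e_def)
    ultimately have "e u \<in> topspace ?X" using ab(2) by (simp add: topspace_geometric_realization)
    then show ?thesis using that ab(1) by (simp add: W_def e_def)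
  qed
  have "inj_on e {0<..<1}"
    by (rule inj_onI) (auto simp: e_def fun_eq_iff split: if_splits)
  then have "infinite (e ` {0<..<1})" by (simp add: finite_image_iff)
  then obtain V :: "(real \<times> real) set" and h x where V: "open V" "continuous_on V h" "inj_on h V"
    "h ` V \<subseteq> \<phi> ` W" "x \<in> e ` {0<..<1}" "\<phi> x \<in> h ` V"
    using almost_surface_planar_image[OF X W _ _ cont inj] eW by (metis image_subsetI)
  obtain u where u: "\<phi> x = (0, u)" using V(5) ab(1) by (auto simp: \<phi>_def e_def)
  have "open (h ` V)" using V(1-3) invariance_of_domain by blast
  moreover have "(0, u) \<in> h ` V" using V(6) u by simp
  ultimately obtain A B where AB: "open A" "(0::real) \<in> A" "u \<in> B" "A \<times> B \<subseteq> h ` V"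
    using open_prod_elim by (metis mem_Sigma_iff)
  then obtain d where "d > 0" "cball 0 d \<subseteq> A" using open_contains_cball by blast
  \<comment> \<open>Openness forces the image across the boundary line, to a point with negative weight at \<open>s\<close>.\<close>
  then have "(- d, u) \<in> h ` V" using AB by (auto simp: subset_iff)
  then obtain t where t: "t \<in> W" "1 - t a - t b = - d"
    using V(4) by (auto simp: \<phi>_def)
  have "t a + t b \<le> (\<Sum>v\<in>{s, a, b}. t v)"
    using nonneg[OF t(1)] ab(1) sum_mono2[of "{s, a, b}" "{a, b}" t] by auto
  then show False using t total[OF t(1)] \<open>d > 0\<close> by simp
qed

lemma not_almost_surface_tetrahedron:
  assumes abcd: "distinct [a, b, c, d]" "{a, b, c, d} \<in> K"
  shows "\<not> almost_surface (geometric_realization K)"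
proof
  let ?X = "geometric_realization K"
  assume X: "almost_surface ?X"
  define D :: "(real \<times> real \<times> real) set" where
    "D = {p. 0 < fst p \<and> 0 < fst (snd p) \<and> 0 < snd (snd p) \<and> fst p + fst (snd p) + snd (snd p) < 1}"
  define \<psi> :: "real \<times> real \<times> real \<Rightarrow> 'a \<Rightarrow> real" where
    "\<psi> = (\<lambda>p v. if v = a then fst p else if v = b then fst (snd p) else if v = c then snd (snd p)
       else if v = d then 1 - fst p - fst (snd p) - snd (snd p) else 0)"
  have "open D"
    unfolding D_def by (intro open_Collect_conj open_Collect_less continuous_intros)
  moreover have "(1/5, 1/5, 1/5) \<in> D" by (simp add: D_def)
  moreover have "\<psi> p \<in> topspace ?X" if "p \<in> D" for p
  proof -
    have "{v. \<psi> p v \<noteq> 0} = {a, b, c, d}" using that by (auto simp: \<psi>_def D_def)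
    moreover have "0 \<le> \<psi> p v" for v using that by (simp add: \<psi>_def D_def)
    moreover have "(\<Sum>v\<in>{a, b, c, d}. \<psi> p v) = 1" using abcd(1) by (auto simp: \<psi>_def)
    ultimately show ?thesis using abcd(2) by (simp add: topspace_geometric_realization)
  qed
  moreover have "continuous_on D (\<lambda>p. \<psi> p v)" for v
  proof -
    consider "v = a" | "v = b" "v \<noteq> a" | "v = c" "v \<noteq> a" "v \<noteq> b"
      | "v = d" "v \<noteq> a" "v \<noteq> b" "v \<noteq> c" | "v \<noteq> a" "v \<noteq> b" "v \<noteq> c" "v \<noteq> d" by blast
    then show ?thesis by cases (simp_all add: \<psi>_def continuous_intros)
  qed
  then have "continuous_on D \<psi>" by (rule continuous_on_coordinatewise_then_product)
  ultimately have "continuous_map (top_of_set D) ?X \<psi>"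
    by (auto simp: geometric_realization_def continuous_map_in_subtopology)
  moreover have "inj_on \<psi> D"
  proof (rule inj_onI)
    fix p p' assume "\<psi> p = \<psi> p'"
    then have "\<psi> p a = \<psi> p' a" "\<psi> p b = \<psi> p' b" "\<psi> p c = \<psi> p' c" by auto
    then show "p = p'" using abcd(1) by (auto simp: \<psi>_def prod_eq_iff)
  qed
  ultimately show False
    using almost_surface_no_solid[OF X] \<open>open D\<close> \<open>(1/5, 1/5, 1/5) \<in> D\<close> by blast
qed

lemma card_ge_4_obtains:
  assumes "4 \<le> card A"
  obtains a b c d where "distinct [a, b, c, d]" "{a, b, c, d} \<subseteq> A"
proof -
  obtain B where B: "B \<subseteq> A" "card B = 4" "finite B"
    using assms by (rule obtain_subset_with_card_n)
  then obtain xs where xs: "set xs = B" "distinct xs" using finite_distinct_list by metis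
  then have "length xs = Suc (Suc (Suc (Suc 0)))" using B(2) distinct_card by fastforce
  then obtain a b c d where "xs = [a, b, c, d]" by (auto simp: length_Suc_conv)
  then show ?thesis using that xs B(1) by auto
qed

text \<open>
  Coning a simplex off at \<open>s\<close> raises its dimension unless it already contains \<open>s\<close>. Hence in top
  dimension every simplex contains \<open>s\<close>, and the face opposite to \<open>s\<close> lies in no other one.
\<close>

lemma not_almost_surface_cone:
  assumes fin: "\<And>\<sigma>. \<sigma> \<in> K \<Longrightarrow> finite \<sigma>"
    and sub: "\<And>\<sigma> \<tau>. \<sigma> \<in> K \<Longrightarrow> \<tau> \<subseteq> \<sigma> \<Longrightarrow> \<tau> \<noteq> {} \<Longrightarrow> \<tau> \<in> K"
    and apex: "\<And>\<sigma>. \<sigma> \<in> K \<Longrightarrow> insert s \<sigma> \<in> K"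
  shows "\<not> almost_surface (geometric_realization K)"
proof
  assume X: "almost_surface (geometric_realization K)"
  have le3: "card \<sigma> \<le> 3" if "\<sigma> \<in> K" for \<sigma>
  proof (rule ccontr)
    assume "\<not> card \<sigma> \<le> 3"
    then have "4 \<le> card \<sigma>" by simp
    then obtain a b c d where abcd: "distinct [a, b, c, d]" "{a, b, c, d} \<subseteq> \<sigma>"
      by (rule card_ge_4_obtains)
    then have "{a, b, c, d} \<in> K" using sub[OF that abcd(2)] by simp
    then show False using not_almost_surface_tetrahedron[OF abcd(1)] X by simp
  qed
  consider (three) \<sigma> where "\<sigma> \<in> K" "card \<sigma> = 3"
    | (two) \<sigma> where "\<sigma> \<in> K" "card \<sigma> = 2" "\<And>\<rho>. \<rho> \<in> K \<Longrightarrow> card \<rho> \<le> 2"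
    | (one) "\<And>\<rho>. \<rho> \<in> K \<Longrightarrow> card \<rho> \<le> 1"
    using le3 by (metis le_antisym not_less_eq_eq numeral_2_eq_2 numeral_3_eq_3 One_nat_def)
  then show False
  proof cases
    case three
    have "s \<in> \<sigma>"
      using le3[OF apex[OF three(1)]] three fin[OF three(1)] by (auto simp: card_insert_if split: if_splits)
    then have "card (\<sigma> - {s}) = 2" using three by simp
    then obtain a b where ab: "\<sigma> - {s} = {a, b}" "a \<noteq> b" by (auto simp: card_2_iff)
    have "\<rho> \<subseteq> {s, a, b}" if "\<rho> \<in> K" "{a, b} \<subseteq> \<rho>" for \<rho>
    proof -
      have "\<sigma> \<subseteq> insert s (\<sigma> - {s})" by blast
      also have "\<dots> \<subseteq> insert s \<rho>" unfolding ab(1) using that(2) by blast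
      finally have "\<sigma> \<subseteq> insert s \<rho>" .
      moreover have "finite (insert s \<rho>)" using fin that by simp
      moreover have "card (insert s \<rho>) \<le> card \<sigma>" using le3[OF apex] that three by simp
      ultimately have "\<sigma> = insert s \<rho>" by (meson card_seteq)
      then show ?thesis using ab by auto
    qed
    moreover have "{a, b} \<in> K" using sub[OF three(1)] ab by blast
    ultimately show False using X not_almost_surface_free_edge ab(2) by metis
  next
    case two
    obtain a b where ab: "\<sigma> = {a, b}" "a \<noteq> b" using two by (auto simp: card_2_iff)
    have "\<rho> \<subseteq> {a, a, b}" if "\<rho> \<in> K" "{a, b} \<subseteq> \<rho>" for \<rho>
      using card_seteq[OF fin[OF that(1)] that(2)] two(3)[OF that(1)] ab by auto
    then show False using X not_almost_surface_free_edge[of a b K a] ab two(1) by blast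
  next
    case one
    have K: "\<rho> = {s}" if "\<rho> \<in> K" "\<rho> \<noteq> {}" for \<rho>
    proof -
      have "card (insert s \<rho>) \<le> 1" using one apex that by blast
      then have "insert s \<rho> \<subseteq> {s}"
        using card_seteq[of "insert s \<rho>" "{s}"] fin that by auto
      then show ?thesis using that by auto
    qed
    have "t = (\<lambda>v. if v = s then 1 else 0)" if t: "t \<in> topspace (geometric_realization K)" for t
    proof -
      have "{v. t v \<noteq> 0} \<noteq> {}" "{v. t v \<noteq> 0} \<in> K" "(\<Sum>v | t v \<noteq> 0. t v) = 1"
        using t unfolding topspace_geometric_realization mem_Collect_eq
        by (metis sum.empty zero_neq_one, blast+)
      then show ?thesis using K by fastforce
    qed
    then have "topspace (geometric_realization K) \<subseteq> {\<lambda>v. if v = s then 1 else 0}" by blast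
    then show False using almost_surface_infinite[OF X] finite_subset by blast
  qed
qed

section \<open>The two surfaces\<close>

text \<open>
  A chart of a quotient is given by representatives \<open>r\<close> of its points together with a continuous
  local inverse \<open>k\<close>, defined on an open set \<open>N\<close> that contains all points identified with one in the
  range of \<open>r\<close>. The inverse makes the chart an open map: the preimage in \<open>S\<close> of
  the image of an open \<open>U\<close> is the preimage of \<open>U\<close> under \<open>k\<close>.
\<close>

lemma chart_at_quotient:
  fixes r :: "real \<times> real \<Rightarrow> 'c :: topological_space"
  assumes q: "quotient_map (top_of_set S) X q" and V: "open V" and rV: "\<And>v. v \<in> V \<Longrightarrow> r v \<in> S"
    and cont: "continuous_map (top_of_set V) X (\<lambda>v. q (r v))"
    and N: "openin (top_of_set S) N" and k: "continuous_on N k"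
    and sect: "\<And>p. p \<in> N \<Longrightarrow> k p \<in> V \<Longrightarrow> q (r (k p)) = q p"
    and uniq: "\<And>p v. p \<in> S \<Longrightarrow> v \<in> V \<Longrightarrow> q p = q (r v) \<Longrightarrow> p \<in> N \<and> k p = v"
    and v: "v \<in> V"
  shows "chart_at X (q (r v))"
proof -
  have "open_map (top_of_set V) X (\<lambda>v. q (r v))"
    unfolding open_map_def
  proof (intro allI impI)
    fix U assume "openin (top_of_set V) U"
    then have U: "open U" "U \<subseteq> V" using V openin_open_eq by blast+
    have "N \<subseteq> S" using openin_subset[OF N] by simp
    have "{p \<in> S. q p \<in> (\<lambda>v. q (r v)) ` U} = N \<inter> k -` U"
    proof
      show "{p \<in> S. q p \<in> (\<lambda>v. q (r v)) ` U} \<subseteq> N \<inter> k -` U"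
        using uniq U(2) by blast
      show "N \<inter> k -` U \<subseteq> {p \<in> S. q p \<in> (\<lambda>v. q (r v)) ` U}"
      proof
        fix p assume p: "p \<in> N \<inter> k -` U"
        then have "q p = q (r (k p))" using sect U(2) by auto
        then show "p \<in> {p \<in> S. q p \<in> (\<lambda>v. q (r v)) ` U}" using p \<open>N \<subseteq> S\<close> by auto
      qed
    qed
    moreover have "openin (top_of_set S) (N \<inter> k -` U)"
      using continuous_openin_preimage_gen[OF k U(1)] N by (rule openin_trans)
    moreover have "(\<lambda>v. q (r v)) ` U \<subseteq> topspace X"
      using continuous_map_image_subset_topspace[OF cont] U(2) by auto
    ultimately show "openin X ((\<lambda>v. q (r v)) ` U)"
      using q unfolding quotient_map_def by (metis topspace_euclidean_subtopology)
  qed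
  moreover have "inj_on (\<lambda>v. q (r v)) V"
  proof (rule inj_onI)
    fix v w assume vw: "v \<in> V" "w \<in> V" "q (r v) = q (r w)"
    have "k (r v) = w" using uniq[OF rV[OF vw(1)] vw(2,3)] by simp
    moreover have "k (r v) = v" using uniq[OF rV[OF vw(1)] vw(1) refl] by simp
    ultimately show "v = w" by simp
  qed
  ultimately show ?thesis
    unfolding chart_at_def using V cont imageI[OF v, of "\<lambda>v. q (r v)"]
    by (intro exI[of _ V] exI[of _ "\<lambda>v. q (r v)"] conjI) simp_all
qed

text \<open>
  Points of the square are shown to be inequivalent by means of functions that respect the generating
  identifications.
\<close>

lemma klein_rel_invariant:
  assumes h: "\<And>p p'. klein_glue p p' \<Longrightarrow> h p = h p'"
    and p: "p \<in> unit_square" and eq: "klein_rel `` {p} = klein_rel `` {p'}"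
  shows "h p = h p'"
proof -
  have "p \<in> klein_rel `` {p}"
    by (rule equiv_class_self[OF equiv_klein_rel]) (use p in simp)
  then have "(p', p) \<in> klein_rel" unfolding eq by simp
  then have "equivclp klein_glue p' p" by (simp add: klein_rel_def)
  then show ?thesis by (induction rule: equivclp_induct) (auto dest: h)
qed

lemma klein_rel_glue:
  assumes "klein_glue p p'"
  shows "klein_rel `` {p} = klein_rel `` {p'}"
proof -
  have "p \<in> unit_square" "p' \<in> unit_square"
    using assms by (auto simp: unit_square_def elim: klein_glue.cases)
  then have "(p, p') \<in> klein_rel" using assms by (auto simp: klein_rel_def)
  then show ?thesis by (rule equiv_class_eq[OF equiv_klein_rel])
qed

text \<open>
  Three kinds of charts cover everything but the corners: the open square, a strip around the
  identified vertical sides, and a strip around the identified horizontal sides, which is glued with a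
  flip. In each case the invariant \<open>h\<close> is \<open>None\<close> on the sides that do not meet the chart and
  otherwise names a canonical representative.
\<close>

lemma almost_surface_klein_bottle: "almost_surface klein_bottle"
proof -
  define q where "q p = klein_rel `` {p}" for p
  have q: "quotient_map (top_of_set unit_square) klein_bottle q"
    using quotient_map_quotient_topology[OF equiv_klein_rel] by (simp add: klein_bottle_def q_def[abs_def])
  have topspace: "topspace klein_bottle = q ` unit_square"
    using quotient_imp_surjective_map[OF q] by simp
  have q_continuous: "continuous_map (top_of_set A) klein_bottle (\<lambda>v. q (f v))"
    if "continuous_on A f" "f ` A \<subseteq> unit_square" for f :: "real \<times> real \<Rightarrow> _" and A
    using continuous_map_compose[OF _ quotient_imp_continuous_map[OF q], of "top_of_set A" f] that
    by (auto simp: continuous_map_in_subtopology comp_def)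
  have inv: "h p = h p'" if "\<And>p p'. klein_glue p p' \<Longrightarrow> h p = h p'" "p \<in> unit_square" "q p = q p'"
    for h :: "real \<times> real \<Rightarrow> (real \<times> real) option" and p p'
    using klein_rel_invariant that unfolding q_def by blast
  have glue: "q p = q p'" if "klein_glue p p'" for p p'
    using klein_rel_glue that unfolding q_def by blast
  have interior: "chart_at klein_bottle (q v)" if "v \<in> {0<..<1} \<times> {0<..<1}" for v
  proof (rule chart_at_quotient[OF q, where r = "\<lambda>p. p" and k = "\<lambda>p. p" and
        V = "{0<..<1} \<times> {0<..<1}" and N = "{0<..<1} \<times> {0<..<1}"])
    let ?V = "{0<..<1} \<times> {0<..<1} :: (real \<times> real) set"
    have sub: "?V \<subseteq> unit_square" by (auto simp: unit_square_def)
    show "open ?V" by (intro open_Times) auto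
    then show "openin (top_of_set unit_square) ?V" using sub by (simp add: openin_open_eq open_subset)
    show "continuous_map (top_of_set ?V) klein_bottle q"
      using q_continuous[of ?V "\<lambda>p. p"] sub by simp
    show "w \<in> ?V \<Longrightarrow> w \<in> unit_square" for w using sub by auto
    show "p \<in> ?V \<and> p = w" if "p \<in> unit_square" "w \<in> ?V" "q p = q w" for p w
    proof -
      define h where "h p = (if p \<in> ?V then Some p else None)" for p
      have "h p = h p'" if "klein_glue p p'" for p p'
        using that by (auto simp: h_def elim!: klein_glue.cases)
      then have "h p = h w" using inv that by blast
      then show ?thesis using that(2) by (simp add: h_def split: if_splits)
    qed
  qed (use that in auto)
  have vertical: "chart_at klein_bottle (q (0, y))" if "y \<in> {0<..<1}" for y
  proof -
    \<comment> \<open>The half of the strip left of the side is the right-hand end of the square, translated. The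
      line \<open>fst p = 1/2\<close>, where \<open>k\<close> jumps, is not in \<open>N\<close>.\<close>
    define V :: "(real \<times> real) set" where "V = {-1/2<..<1/2} \<times> {0<..<1}"
    define r :: "real \<times> real \<Rightarrow> real \<times> real" where
      "r v = (if 0 \<le> fst v then v else (fst v + 1, snd v))" for v
    define N :: "(real \<times> real) set" where
      "N = unit_square \<inter> {p. fst p \<noteq> 1/2 \<and> 0 < snd p \<and> snd p < 1}"
    define k :: "real \<times> real \<Rightarrow> real \<times> real" where
      "k p = (if fst p \<le> 1/2 then p else (fst p - 1, snd p))" for p
    have "chart_at klein_bottle (q (r (0, y)))"
    proof (rule chart_at_quotient[OF q, where r = r and k = k and V = V and N = N])
      show "open V" unfolding V_def by (intro open_Times) auto
      show "r v \<in> unit_square" if "v \<in> V" for v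
        using that by (auto simp: V_def r_def unit_square_def)
      have "continuous_map (top_of_set V) klein_bottle
          (\<lambda>v. if 0 \<le> fst v then q v else q (fst v + 1, snd v))"
      proof (rule continuous_map_cases_le)
        show "continuous_map (subtopology (top_of_set V) {v \<in> topspace (top_of_set V). 0 \<le> fst v}) klein_bottle q"
          unfolding subtopology_subtopology
          by (rule q_continuous[where f = "\<lambda>p. p"]) (auto simp: V_def unit_square_def)
        show "continuous_map (subtopology (top_of_set V) {v \<in> topspace (top_of_set V). fst v \<le> 0}) klein_bottle
           (\<lambda>v. q (fst v + 1, snd v))"
          unfolding subtopology_subtopology
          by (rule q_continuous) (auto simp: V_def unit_square_def intro!: continuous_intros)
        show "q v = q (fst v + 1, snd v)" if "v \<in> topspace (top_of_set V)" "0 = fst v" for v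
        proof -
          have "klein_glue (0, snd v) (1, snd v)"
            using that(1) by (intro klein_glue.intros) (auto simp: V_def)
          then have "q (0, snd v) = q (1, snd v)" by (rule glue)
          then show ?thesis using that(2) by (cases v) simp
        qed
      qed (auto intro!: continuous_intros)
      then show "continuous_map (top_of_set V) klein_bottle (\<lambda>v. q (r v))"
        by (simp add: r_def if_distrib cong: if_cong)
      have "open {p :: real \<times> real. fst p \<noteq> 1/2 \<and> 0 < snd p \<and> snd p < 1}"
        by (intro open_Collect_conj open_Collect_less open_Collect_neq continuous_intros)
      then show "openin (top_of_set unit_square) N" by (auto simp: N_def)
      show "continuous_on N k"
        unfolding k_def by (rule continuous_on_cases_le) (auto simp: N_def intro!: continuous_intros)
      show "q (r (k p)) = q p" if "p \<in> N" "k p \<in> V" for p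
      proof (cases "fst p = 1")
        case True
        have "r (k p) = (0, snd p)" using True by (simp add: r_def k_def)
        moreover have "klein_glue (0, snd p) (1, snd p)"
          using that by (intro klein_glue.intros) (auto simp: N_def)
        ultimately show ?thesis using glue[of "(0, snd p)" p] True by (cases p) auto
      next
        case False
        then have "r (k p) = p" using that by (cases p) (auto simp: r_def k_def N_def unit_square_def)
        then show ?thesis by simp
      qed
      show "p \<in> N \<and> k p = v" if "p \<in> unit_square" "v \<in> V" "q p = q (r v)" for p v
      proof -
        define h where "h p = (if snd p = 0 \<or> snd p = 1 then None
          else Some (if fst p = 1 then (0, snd p) else p))" for p :: "real \<times> real"
        have "h p = h p'" if "klein_glue p p'" for p p'
          using that by (auto simp: h_def elim!: klein_glue.cases)
        then have "h p = h (r v)" using inv that by blast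
        then show ?thesis
          using that(1,2) by (cases p; cases v)
            (auto simp: h_def V_def r_def N_def k_def unit_square_def split: if_splits)
      qed
      show "(0, y) \<in> V" using that by (simp add: V_def)
    qed
    then show ?thesis by (simp add: r_def)
  qed
  have horizontal: "chart_at klein_bottle (q (x, 0))" if "x \<in> {0<..<1}" for x
  proof -
    define V :: "(real \<times> real) set" where "V = {0<..<1} \<times> {-1/2<..<1/2}"
    define r :: "real \<times> real \<Rightarrow> real \<times> real" where
      "r v = (if 0 \<le> snd v then v else (1 - fst v, snd v + 1))" for v
    define N :: "(real \<times> real) set" where
      "N = unit_square \<inter> {p. snd p \<noteq> 1/2 \<and> 0 < fst p \<and> fst p < 1}"
    define k :: "real \<times> real \<Rightarrow> real \<times> real" where
      "k p = (if snd p \<le> 1/2 then p else (1 - fst p, snd p - 1))" for p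
    have "chart_at klein_bottle (q (r (x, 0)))"
    proof (rule chart_at_quotient[OF q, where r = r and k = k and V = V and N = N])
      show "open V" unfolding V_def by (intro open_Times) auto
      show "r v \<in> unit_square" if "v \<in> V" for v
        using that by (auto simp: V_def r_def unit_square_def)
      have "continuous_map (top_of_set V) klein_bottle
          (\<lambda>v. if 0 \<le> snd v then q v else q (1 - fst v, snd v + 1))"
      proof (rule continuous_map_cases_le)
        show "continuous_map (subtopology (top_of_set V) {v \<in> topspace (top_of_set V). 0 \<le> snd v}) klein_bottle q"
          unfolding subtopology_subtopology
          by (rule q_continuous[where f = "\<lambda>p. p"]) (auto simp: V_def unit_square_def)
        show "continuous_map (subtopology (top_of_set V) {v \<in> topspace (top_of_set V). snd v \<le> 0}) klein_bottle
           (\<lambda>v. q (1 - fst v, snd v + 1))"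
          unfolding subtopology_subtopology
          by (rule q_continuous) (auto simp: V_def unit_square_def intro!: continuous_intros)
        show "q v = q (1 - fst v, snd v + 1)" if "v \<in> topspace (top_of_set V)" "0 = snd v" for v
        proof -
          have "klein_glue (fst v, 0) (1 - fst v, 1)"
            using that(1) by (intro klein_glue.intros) (auto simp: V_def)
          then have "q (fst v, 0) = q (1 - fst v, 1)" by (rule glue)
          then show ?thesis using that(2) by (cases v) simp
        qed
      qed (auto intro!: continuous_intros)
      then show "continuous_map (top_of_set V) klein_bottle (\<lambda>v. q (r v))"
        by (simp add: r_def if_distrib cong: if_cong)
      have "open {p :: real \<times> real. snd p \<noteq> 1/2 \<and> 0 < fst p \<and> fst p < 1}"
        by (intro open_Collect_conj open_Collect_less open_Collect_neq continuous_intros)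
      then show "openin (top_of_set unit_square) N" by (auto simp: N_def)
      show "continuous_on N k"
        unfolding k_def by (rule continuous_on_cases_le) (auto simp: N_def intro!: continuous_intros)
      show "q (r (k p)) = q p" if "p \<in> N" "k p \<in> V" for p
      proof (cases "snd p = 1")
        case True
        have "r (k p) = (1 - fst p, 0)" using True by (simp add: r_def k_def)
        moreover have "klein_glue (1 - fst p, 0) (1 - (1 - fst p), 1)"
          using that by (intro klein_glue.intros) (auto simp: N_def)
        ultimately show ?thesis using glue[of "(1 - fst p, 0)" p] True by (cases p) auto
      next
        case False
        then have "r (k p) = p" using that by (cases p) (auto simp: r_def k_def N_def unit_square_def)
        then show ?thesis by simp
      qed
      show "p \<in> N \<and> k p = v" if "p \<in> unit_square" "v \<in> V" "q p = q (r v)" for p v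
      proof -
        define h where "h p = (if fst p = 0 \<or> fst p = 1 then None
          else Some (if snd p = 1 then (1 - fst p, 0) else p))" for p :: "real \<times> real"
        have "h p = h p'" if "klein_glue p p'" for p p'
          using that by (auto simp: h_def elim!: klein_glue.cases)
        then have "h p = h (r v)" using inv that by blast
        then show ?thesis
          using that(1,2) by (cases p; cases v)
            (auto simp: h_def V_def r_def N_def k_def unit_square_def split: if_splits)
      qed
      show "(x, 0) \<in> V" using that by (simp add: V_def)
    qed
    then show ?thesis by (simp add: r_def)
  qed
  define F where "F = q ` ({0, 1} \<times> {0, 1})"
  have charts: "chart_at klein_bottle z" if z: "z \<in> topspace klein_bottle - F" for z
  proof -
    obtain x y where xy: "z = q (x, y)" "x \<in> {0..1}" "y \<in> {0..1}"
      using z unfolding topspace unit_square_def by auto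
    have "\<not> (x \<in> {0, 1} \<and> y \<in> {0, 1})" using z xy(1) by (auto simp: F_def)
    then have "x \<noteq> 0 \<and> x \<noteq> 1 \<or> y \<noteq> 0 \<and> y \<noteq> 1" by simp
    moreover have "x = 0 \<or> x = 1 \<or> x \<in> {0<..<1}" "y = 0 \<or> y = 1 \<or> y \<in> {0<..<1}"
      using xy(2,3) by auto
    ultimately consider "x \<in> {0<..<1}" "y \<in> {0<..<1}" | "x = 0" "y \<in> {0<..<1}" | "x = 1" "y \<in> {0<..<1}"
      | "y = 0" "x \<in> {0<..<1}" | "y = 1" "x \<in> {0<..<1}"
      by argo
    then show ?thesis
    proof cases
      case 3
      then have "q (0, y) = z" using glue[of "(0, y)" "(1, y)"] xy by (simp add: klein_glue.intros)
      then show ?thesis using vertical[of y] 3 by simp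
    next
      case 5
      have "klein_glue (1 - x, 0) (1 - (1 - x), 1)" using 5 by (intro klein_glue.intros) auto
      then have "q (1 - x, 0) = z" using glue 5 xy by fastforce
      then show ?thesis using horizontal[of "1 - x"] 5 by simp
    qed (use interior vertical horizontal xy in auto)
  qed
  have "q (1/2, 1/2) \<notin> F"
  proof
    assume "q (1/2, 1/2) \<in> F"
    then obtain p where "q (1/2, 1/2) = q p" "p \<in> {0, 1} \<times> {0, 1}"
      unfolding F_def by (rule imageE)
    define h where "h p = (if p = (1/2, 1/2) then Some p else None)" for p :: "real \<times> real"
    have "h p = h p'" if "klein_glue p p'" for p p'
      using that by (auto simp: h_def elim!: klein_glue.cases)
    moreover have "(1/2, 1/2) \<in> unit_square" by (simp add: unit_square_def)
    ultimately have "h (1/2, 1/2) = h p" using inv \<open>q (1/2, 1/2) = q p\<close> by blast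
    then show False using \<open>p \<in> {0, 1} \<times> {0, 1}\<close> by (auto simp: h_def split: if_splits)
  qed
  moreover have "q (1/2, 1/2) \<in> topspace klein_bottle" by (auto simp: topspace unit_square_def)
  ultimately have "\<not> topspace klein_bottle \<subseteq> F" by blast
  moreover have "finite F" by (simp add: F_def)
  ultimately show ?thesis unfolding almost_surface_def using charts by blast
qed

text \<open>
  These are the usual affine charts: where coordinate \<open>i\<close> does not vanish, the quotients by it of the
  other two coordinates are unaffected by scaling, in particular by the antipodal map, and determine
  the line through the point.
\<close>

lemma almost_surface_real_projective_plane: "almost_surface real_projective_plane"
proof -
  define S :: "(real ^ 3) set" where "S = sphere 0 1"
  define q where "q p = antipodal_rel `` {p}" for p
  have q: "quotient_map (top_of_set S) real_projective_plane q"
    using quotient_map_quotient_topology[OF equiv_antipodal_rel]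
    by (simp add: real_projective_plane_def q_def[abs_def] S_def)
  have topspace: "topspace real_projective_plane = q ` S"
    using quotient_imp_surjective_map[OF q] by simp
  have q_eq: "q x = q y \<longleftrightarrow> y = x \<or> y = - x" if "x \<in> S" "y \<in> S" for x y
    using eq_equiv_class_iff[OF equiv_antipodal_rel, of x y] that
    by (auto simp: q_def antipodal_rel_def S_def)
  have affine: "chart_at real_projective_plane (q x)"
    if ijl: "(UNIV :: 3 set) = {i, j, l}" "i \<noteq> j" "i \<noteq> l" "j \<noteq> l" and x: "x \<in> S" "x $ i \<noteq> 0"
    for i j l x
  proof -
    define w :: "real \<times> real \<Rightarrow> real ^ 3" where
      "w v = axis i 1 + fst v *\<^sub>R axis j 1 + snd v *\<^sub>R axis l 1" for v
    have w: "w v $ i = 1" "w v $ j = fst v" "w v $ l = snd v" for v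
      using ijl by (auto simp: w_def axis_def)
    then have w0: "w v \<noteq> 0" for v by (metis zero_index zero_neq_one)
    define r where "r v = sgn (w v)" for v
    define k :: "real ^ 3 \<Rightarrow> real \<times> real" where "k p = (p $ j / p $ i, p $ l / p $ i)" for p
    have r: "r v \<in> S" for v using w0[of v] by (simp add: r_def S_def norm_sgn)
    have k_scale: "k (c *\<^sub>R p) = k p" if "c \<noteq> 0" for c p
      using that by (simp add: k_def)
    have kr: "k (r v) = v" and ri: "r v $ i \<noteq> 0" for v
    proof -
      show "k (r v) = v"
        using k_scale[of "inverse (norm (w v))" "w v"] w0[of v] w[of v]
        by (simp add: r_def sgn_div_norm k_def)
      show "r v $ i \<noteq> 0" using w0[of v] w[of v] by (simp add: r_def sgn_div_norm)
    qed
    have sect: "q (r (k p)) = q p" if p: "p \<in> S" "p $ i \<noteq> 0" for p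
    proof -
      have "w (k p) = inverse (p $ i) *\<^sub>R p"
        unfolding vec_eq_iff
      proof
        fix m
        have "m \<in> {i, j, l}" unfolding ijl(1)[symmetric] by simp
        then show "w (k p) $ m = (inverse (p $ i) *\<^sub>R p) $ m"
          using p(2) by (auto simp: w k_def field_simps)
      qed
      then have "r (k p) = sgn (inverse (p $ i)) *\<^sub>R p"
        using p by (simp add: r_def sgn_scaleR S_def sgn_div_norm)
      then have "r (k p) = p \<or> r (k p) = - p"
        using p(2) by (auto simp: sgn_real_def)
      then show ?thesis using q_eq[of p "r (k p)"] r p(1) by auto
    qed
    have "chart_at real_projective_plane (q (r (k x)))"
    proof (rule chart_at_quotient[OF q, where r = r and k = k and V = UNIV and
          N = "S \<inter> {p. p $ i \<noteq> 0}"])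
      have "continuous_on UNIV r"
        unfolding r_def w_def using w0 by (auto simp: w_def intro!: continuous_intros)
      then have "continuous_map euclidean (top_of_set S) r"
        using r by (auto simp: continuous_map_in_subtopology)
      then show "continuous_map (top_of_set UNIV) real_projective_plane (\<lambda>v. q (r v))"
        using continuous_map_compose[OF _ quotient_imp_continuous_map[OF q]] by (simp add: comp_def)
      have "open {p :: real ^ 3. p $ i \<noteq> 0}"
        by (intro open_Collect_neq continuous_intros)
      then show "openin (top_of_set S) (S \<inter> {p. p $ i \<noteq> 0})" by auto
      show "continuous_on (S \<inter> {p. p $ i \<noteq> 0}) k"
        unfolding k_def by (auto intro!: continuous_intros)
      show "p \<in> S \<inter> {p. p $ i \<noteq> 0} \<and> k p = v" if "p \<in> S" "q p = q (r v)" for p v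
      proof -
        have "r v = p \<or> r v = - p" using q_eq[of p "r v"] r that by auto
        then have "p = 1 *\<^sub>R r v \<or> p = (-1) *\<^sub>R r v" by auto
        then have "p $ i \<noteq> 0 \<and> k p = v"
          using k_scale[of 1 "r v"] k_scale[of "-1" "r v"] kr[of v] ri[of v] by auto
        then show ?thesis using that by auto
      qed
    qed (use r sect in auto)
    then show ?thesis using sect[OF x] by simp
  qed
  have charts: "chart_at real_projective_plane z" if z: "z \<in> topspace real_projective_plane" for z
  proof -
    obtain x where x: "x \<in> S" "z = q x" using z topspace by auto
    then have "x \<noteq> 0" by (auto simp: S_def)
    then have "x $ 1 \<noteq> 0 \<or> x $ 2 \<noteq> 0 \<or> x $ 3 \<noteq> 0" by (auto simp: vec_eq_iff forall_3)
    moreover have "(UNIV :: 3 set) = {2, 1, 3}" "(UNIV :: 3 set) = {3, 1, 2}"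
      by (auto simp: UNIV_3)
    ultimately show ?thesis
      using affine[OF UNIV_3 _ _ _ x(1)] affine[of 2 1 3, OF _ _ _ _ x(1)]
        affine[of 3 1 2, OF _ _ _ _ x(1)] x(2) by auto
  qed
  have "S \<noteq> {}" by (simp add: S_def)
  then have "\<not> topspace real_projective_plane \<subseteq> {}" using topspace by simp
  then show ?thesis unfolding almost_surface_def using charts by blast
qed

section \<open>Zero-divisor complexes\<close>

text \<open>
  Two powers of \<open>x\<close> coincide, so the powers are periodic from some exponent \<open>i\<close> on. At a positive
  multiple \<open>n \<ge> i\<close> of the period, the exponents \<open>n\<close> and \<open>n + n\<close> give the same power.
\<close>

lemma (in monoid) finite_ex_idempotent_power:
  assumes "finite (carrier G)" "x \<in> carrier G"
  obtains n :: nat where "0 < n" "(x [^] n) \<otimes> (x [^] n) = x [^] n"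
proof -
  have "finite (range (\<lambda>n::nat. x [^] n))"
    by (rule finite_subset[OF _ assms(1)]) (use assms(2) in auto)
  then have "\<not> inj (\<lambda>n::nat. x [^] n)" using finite_imageD infinite_UNIV_nat by blast
  then obtain i j :: nat where ij: "x [^] i = x [^] j" "i < j"
    unfolding inj_def by (metis linorder_neqE_nat)
  define p where "p = j - i"
  have period: "x [^] (m + p) = x [^] m" if "i \<le> m" for m
  proof -
    have "x [^] (m + p) = x [^] (m - i) \<otimes> x [^] j"
      using assms(2) that ij(2) by (simp add: nat_pow_mult p_def)
    also have "\<dots> = x [^] m" using assms(2) that ij(1)[symmetric] by (simp add: nat_pow_mult)
    finally show ?thesis .
  qed
  have periods: "x [^] (m + c * p) = x [^] m" if "i \<le> m" for m c
  proof (induction c)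
    case (Suc c)
    have "x [^] (m + Suc c * p) = x [^] (m + c * p + p)" by (simp add: algebra_simps)
    then show ?case using period[of "m + c * p"] that Suc by simp
  qed simp
  define n where "n = Suc i * p"
  have "p > 0" using ij(2) by (simp add: p_def)
  then have "n > 0" "i \<le> n" by (auto simp: n_def) (metis le_add2 le_trans mult_le_mono2 nat_mult_1_right Suc_leI One_nat_def)
  moreover have "x [^] n \<otimes> x [^] n = x [^] n"
    using periods[of n "Suc i"] \<open>i \<le> n\<close> assms(2) by (simp add: nat_pow_mult n_def)
  ultimately show ?thesis using that by blast
qed

lemma zdg_complex_iff:
  "\<sigma> \<in> zdg_complex R \<longleftrightarrow> \<sigma> \<subseteq> zdg_verts R \<and> finite \<sigma> \<and> \<sigma> \<noteq> {} \<and>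
     (\<forall>x\<in>\<sigma>. \<forall>y\<in>\<sigma>. x \<noteq> y \<longrightarrow> x \<otimes>\<^bsub>R\<^esub> y = \<zero>\<^bsub>R\<^esub>)"
  by (auto simp: zdg_complex_def clique_complex_def pairwise_def zdg_adj_def)

lemma (in cring) not_almost_surface_idempotent:
  assumes e: "e \<in> carrier R" "e \<otimes> e = e" "e \<noteq> \<zero>" "e \<noteq> \<one>"
  shows "\<not> almost_surface (geometric_realization (zdg_complex R))"
proof -
  define f where "f = \<one> \<ominus> e"
  have f: "f \<in> carrier R" "e \<otimes> f = \<zero>" "f \<otimes> e = \<zero>" "e \<oplus> f = \<one>" "f \<noteq> \<zero>"
  proof -
    show fR: "f \<in> carrier R" using e by (simp add: f_def)
    show "e \<otimes> f = \<zero>" using e by (simp add: f_def r_distr r_minus minus_eq r_neg)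
    then show "f \<otimes> e = \<zero>" using m_comm e fR by simp
    show sum: "e \<oplus> f = \<one>" using e a_lcomm[of e \<one> "\<ominus> e"] by (simp add: f_def minus_eq r_neg)
    show "f \<noteq> \<zero>" using sum e by auto
  qed
  have "e \<noteq> f" using e f by metis
  moreover have "{e, f} \<in> zdg_complex R"
    using e f by (auto simp: zdg_complex_iff zdg_verts_def zero_divisors_def)
  moreover have "\<rho> \<subseteq> {e, e, f}" if \<rho>: "\<rho> \<in> zdg_complex R" "{e, f} \<subseteq> \<rho>" for \<rho>
  proof
    fix x assume x: "x \<in> \<rho>"
    have xR: "x \<in> carrier R" "x \<noteq> \<zero>"
      using \<rho> x by (auto simp: zdg_complex_iff zdg_verts_def zero_divisors_def)
    show "x \<in> {e, e, f}"
    proof (rule ccontr)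
      assume "x \<notin> {e, e, f}"
      then have "x \<otimes> e = \<zero>" "x \<otimes> f = \<zero>" using \<rho> x by (auto simp: zdg_complex_iff)
      then have "x \<otimes> (e \<oplus> f) = \<zero>" using xR(1) e(1) f(1) by (simp add: r_distr)
      moreover have "x \<otimes> (e \<oplus> f) = x" using xR f(4) by simp
      ultimately show False using xR(2) by simp
    qed
  qed
  ultimately show ?thesis by (rule not_almost_surface_free_edge)
qed

text \<open>
  An element \<open>s\<close> with largest annihilator works. If \<open>z\<close> is nilpotent, the last nonzero product
  \<open>s z\<^sup>l\<close> is annihilated by \<open>z\<close> and by everything that annihilates \<open>s\<close>; by maximality its annihilator
  is that of \<open>s\<close>, which therefore contains \<open>z\<close>.
\<close>

lemma (in cring) ex_common_annihilator:
  assumes fin: "finite (carrier R)" and ne: "zdg_verts R \<noteq> {}"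
    and nilpotent: "\<And>z. z \<in> zdg_verts R \<Longrightarrow> \<exists>n::nat. z [^] n = \<zero>"
  obtains s where "s \<in> zdg_verts R" "\<And>z. z \<in> zdg_verts R \<Longrightarrow> s \<otimes> z = \<zero>"
proof -
  define ann where "ann s = {z \<in> carrier R. s \<otimes> z = \<zero>}" for s
  have finann: "finite (ann s)" for s using fin by (simp add: ann_def)
  obtain v where v: "v \<in> zdg_verts R" using ne by blast
  have "card (ann t) < Suc (card (carrier R))" for t
    using card_mono[OF fin, of "ann t"] by (auto simp: ann_def less_Suc_eq_le)
  then obtain s where s: "s \<in> zdg_verts R" "\<And>t. t \<in> zdg_verts R \<Longrightarrow> card (ann t) \<le> card (ann s)"
    using ex_has_greatest_nat[of "\<lambda>t. t \<in> zdg_verts R" v "\<lambda>t. card (ann t)"] v by blast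
  have sR: "s \<in> carrier R" "s \<noteq> \<zero>" using s(1) by (auto simp: zdg_verts_def zero_divisors_def)
  obtain b where b: "b \<in> carrier R" "b \<noteq> \<zero>" "s \<otimes> b = \<zero>"
    using s(1) by (auto simp: zdg_verts_def zero_divisors_def)
  have "s \<otimes> z = \<zero>" if z: "z \<in> zdg_verts R" for z
  proof -
    have zR: "z \<in> carrier R" using z by (auto simp: zdg_verts_def zero_divisors_def)
    obtain n :: nat where "z [^] n = \<zero>" using nilpotent[OF z] by blast
    then have ex: "s \<otimes> z [^] n = \<zero>" using sR by simp
    define m where "m = (LEAST n::nat. s \<otimes> z [^] n = \<zero>)"
    have m: "s \<otimes> z [^] m = \<zero>" unfolding m_def using ex by (rule LeastI)
    then have "m \<noteq> 0" using sR by (metis nat_pow_0 r_one)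
    then obtain l where l: "m = Suc l" using not0_implies_Suc by blast
    define t where "t = s \<otimes> z [^] l"
    have tR: "t \<in> carrier R" using sR zR by (simp add: t_def)
    have t0: "t \<noteq> \<zero>" using not_less_Least[of l "\<lambda>n. s \<otimes> z [^] n = \<zero>"] l by (auto simp: m_def t_def)
    have ann_t: "x \<in> ann t" if "x \<in> ann s" for x
    proof -
      have x: "x \<in> carrier R" "s \<otimes> x = \<zero>" using that by (auto simp: ann_def)
      have "t \<otimes> x = s \<otimes> x \<otimes> z [^] l" using sR(1) zR x(1) by (simp add: t_def m_ac)
      also have "\<dots> = \<zero>" using x(2) zR by simp
      finally show ?thesis using x(1) by (simp add: ann_def)
    qed
    then have "b \<in> ann t" using b by (simp add: ann_def)
    then have "t \<in> zdg_verts R"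
      using b tR t0 by (auto simp: zdg_verts_def zero_divisors_def ann_def)
    then have "ann s = ann t"
      using ann_t s(2) finann by (intro card_seteq) auto
    moreover have "z \<in> ann t" using m zR sR by (simp add: ann_def t_def l m_assoc)
    ultimately have "z \<in> ann s" by simp
    then show ?thesis by (simp add: ann_def)
  qed
  then show ?thesis using that s(1) by blast
qed

lemma (in cring) not_almost_surface_zdg_complex:
  assumes "finite (carrier R)"
  shows "\<not> almost_surface (geometric_realization (zdg_complex R))"
proof
  assume X: "almost_surface (geometric_realization (zdg_complex R))"
  have idem: "e = \<zero> \<or> e = \<one>" if "e \<in> carrier R" "e \<otimes> e = e" for e
    using not_almost_surface_idempotent X that by blast
  have nilpotent: "\<exists>n::nat. z [^] n = \<zero>" if z: "z \<in> zdg_verts R" for z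
  proof -
    obtain b where zb: "z \<in> carrier R" "b \<in> carrier R" "b \<noteq> \<zero>" "z \<otimes> b = \<zero>"
      using z by (auto simp: zdg_verts_def zero_divisors_def)
    obtain n :: nat where n: "0 < n" "z [^] n \<otimes> z [^] n = z [^] n"
      using finite_ex_idempotent_power[OF assms zb(1)] .
    obtain l where l: "n = Suc l" using n(1) gr0_implies_Suc by blast
    have "z [^] n \<otimes> b = z [^] l \<otimes> (z \<otimes> b)" using zb by (simp add: l m_assoc)
    also have "\<dots> = \<zero>" using zb by simp
    finally have "z [^] n \<noteq> \<one>" using zb by auto
    then show ?thesis using idem[of "z [^] n"] n zb by auto
  qed
  have "zdg_verts R \<noteq> {}"
  proof
    assume "zdg_verts R = {}"
    then have "zdg_complex R = {}" by (auto simp: zdg_complex_iff)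
    then show False using almost_surface_infinite[OF X] by (simp add: topspace_geometric_realization)
  qed
  then obtain s where s: "s \<in> zdg_verts R" "\<And>z. z \<in> zdg_verts R \<Longrightarrow> s \<otimes> z = \<zero>"
    using ex_common_annihilator[OF assms] nilpotent by blast
  have comm: "z \<otimes> s = \<zero>" if z: "z \<in> zdg_verts R" for z
  proof -
    have "z \<in> carrier R" "s \<in> carrier R"
      using z s(1) by (auto simp: zdg_verts_def zero_divisors_def)
    then have "z \<otimes> s = s \<otimes> z" by (rule m_comm)
    then show ?thesis using s(2)[OF z] by simp
  qed
  have "\<not> almost_surface (geometric_realization (zdg_complex R))"
  proof (rule not_almost_surface_cone)
    show "insert s \<sigma> \<in> zdg_complex R" if "\<sigma> \<in> zdg_complex R" for \<sigma>
    proof -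
      have \<sigma>: "\<sigma> \<subseteq> zdg_verts R" "finite \<sigma>" "\<forall>x\<in>\<sigma>. \<forall>y\<in>\<sigma>. x \<noteq> y \<longrightarrow> x \<otimes> y = \<zero>"
        using that by (simp_all add: zdg_complex_iff)
      have "\<forall>x\<in>\<sigma>. s \<otimes> x = \<zero> \<and> x \<otimes> s = \<zero>" using \<sigma>(1) s(2) comm by blast
      then show ?thesis using \<sigma> s(1) unfolding zdg_complex_iff by simp
    qed
  qed (auto simp: zdg_complex_iff intro: finite_subset)
  then show False using X by simp
qed

lemma not_simplicial_decomposition_zdg_complex:
  assumes "cring R" "finite (carrier R)" "almost_surface X"
  shows "\<not> simplicial_decomposition (zdg_complex R) X"
  using cring.not_almost_surface_zdg_complex[OF assms(1,2)] assms(3)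
    almost_surface_homeomorphic_space homeomorphic_space_sym
  unfolding simplicial_decomposition_def by blast

theorem mainTheorem7:
  fixes \<Omega> :: "('a, 'b) ring_scheme"
  assumes "cring \<Omega>" and "\<one>\<^bsub>\<Omega>\<^esub> \<noteq> \<zero>\<^bsub>\<Omega>\<^esub>" and "finite (carrier \<Omega>)"
  shows "\<not> simplicial_decomposition (zdg_complex \<Omega>) klein_bottle
    \<and> \<not> simplicial_decomposition (zdg_complex \<Omega>) real_projective_plane"
  by (intro conjI not_simplicial_decomposition_zdg_complex[OF assms(1,3)]
      almost_surface_klein_bottle almost_surface_real_projective_plane)

end
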